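(* Let $E_1,\dots,E_m$ and $F$ be Banach spaces. If $E_i$ has the Schur property for all $i=1,\dots,m$, then every continuous multilinear operator from $E_1\times\cdots\times E_m$ into $F$ is weakly* Dunford–Pettis at every point. In particular, $\mathcal{L}_{WDP^{*}}^{\mathrm{ev}}(E_1,\dots,E_m;F)=\mathcal{L}(E_1,\dots,E_m;F)$.
   Context: Banach spaces are over $\mathbb{K}=\mathbb{R}$ or $\mathbb{C}$; $F'$ is the topological dual of $F$; $\overset{w}{\to}$ denotes weak convergence of sequences and $\overset{w^*}{\to}$ denotes convergence of sequences in $F'$ for $\sigma(F',F)$; $\mathcal{L}(E_1,\dots,E_m;F)$ is the space of continuous $m$-linear operators. A Banach space has the Schur property if every weakly convergent sequence in it converges in norm. $T\in\mathcal{L}(E_1,\dots,E_m;F)$ is weakly* Dunford–Pettis at every point, $T\in\mathcal{L}_{WDP^{*}}^{\mathrm{ev}}(E_1,\dots,E_m;F)$, if for all $(a_1,\dots,a_m)\in E_1\times\cdots\times E_m$, all sequences $x_j^{(i)}\overset{w}{\to}a_i$ in $E_i$ ($i=1,\dots,m$), and all sequences $f_j\overset{w^*}{\to}f$ in $F'$ with $f\in F'$, one has $f_j(T(x_j^{(1)},\dots,x_j^{(m)}))\to f(T(a_1,\dots,a_m))$. *)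

theory Defs
  imports "HOL-Analysis.Analysis" "HOL-Algebra.Module"
begin

text \<open>
  The real and the complex case are treated uniformly: the scalar field is a subset \<open>K\<close> of the
  complex numbers, which the theorem takes to be \<open>\<real>\<close> (the reals inside the complex numbers) or
  \<open>UNIV\<close>. Normed spaces are carrier-based, so that a family \<open>E\<^sub>1, \<dots>, E\<^sub>m\<close> of different spaces is a
  function into the record type below. Requiring the carriers to lie in one common type \<open>'a\<close> is no
  restriction, since \<open>'a\<close> is arbitrary (for example a disjoint union).
\<close>

definition scalars :: "complex set \<Rightarrow> complex ring" where
  "scalars K = \<lparr>carrier = K, mult = (*), one = 1, zero = 0, add = (+)\<rparr>"

text \<open>The fields \<open>mult\<close> and \<open>one\<close> inherited from the library record of modules are not used.\<close>

record 'a normed_space = "(complex, 'a) module" +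
  nrm :: "'a \<Rightarrow> real"

text \<open>
  The locale \<open>Metric_space\<close> demands nonnegativity and symmetry on the whole type, hence the
  value 0 outside of the carrier.
\<close>

definition norm_dist :: "'a normed_space \<Rightarrow> 'a \<Rightarrow> 'a \<Rightarrow> real" where
  "norm_dist E x y =
     (if x \<in> carrier E \<and> y \<in> carrier E then nrm E (x \<ominus>\<^bsub>E\<^esub> y) else 0)"

definition norm_topology :: "'a normed_space \<Rightarrow> 'a topology" where
  "norm_topology E = Metric_space.mtopology (carrier E) (norm_dist E)"

locale normed_vector_space = Module.module "scalars K" E
  for K :: "complex set" and E :: "'a normed_space" +
  assumes nrm_nonneg: "x \<in> carrier E \<Longrightarrow> 0 \<le> nrm E x"
    and nrm_eq_zero: "x \<in> carrier E \<Longrightarrow> nrm E x = 0 \<longleftrightarrow> x = \<zero>\<^bsub>E\<^esub>"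
    and nrm_smult: "\<lbrakk>c \<in> K; x \<in> carrier E\<rbrakk> \<Longrightarrow> nrm E (c \<odot>\<^bsub>E\<^esub> x) = cmod c * nrm E x"
    and nrm_triangle:
      "\<lbrakk>x \<in> carrier E; y \<in> carrier E\<rbrakk> \<Longrightarrow> nrm E (x \<oplus>\<^bsub>E\<^esub> y) \<le> nrm E x + nrm E y"

locale banach_space = normed_vector_space K E
  for K :: "complex set" and E :: "'a normed_space" +
  assumes complete: "Metric_space.mcomplete (carrier E) (norm_dist E)"

text \<open>
  Functionals and operators are extensional (\<open>undefined\<close> off their domain), so that each of them is
  represented by exactly one HOL function.
\<close>

definition dual :: "complex set \<Rightarrow> 'a normed_space \<Rightarrow> ('a \<Rightarrow> complex) set" where
  "dual K E =
     {\<phi> \<in> carrier E \<rightarrow>\<^sub>E K.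
        (\<forall>x\<in>carrier E. \<forall>y\<in>carrier E. \<phi> (x \<oplus>\<^bsub>E\<^esub> y) = \<phi> x + \<phi> y) \<and>
        (\<forall>c\<in>K. \<forall>x\<in>carrier E. \<phi> (c \<odot>\<^bsub>E\<^esub> x) = c * \<phi> x) \<and>
        continuous_map (norm_topology E) euclidean \<phi>}"

text \<open>The topologies \<open>\<sigma>(E, E')\<close> on \<open>E\<close> and \<open>\<sigma>(F', F)\<close> on \<open>F'\<close>.\<close>

definition weak_topology :: "complex set \<Rightarrow> 'a normed_space \<Rightarrow> 'a topology" where
  "weak_topology K E =
     topology_generated_by {{x \<in> carrier E. \<phi> x \<in> U} |\<phi> U. \<phi> \<in> dual K E \<and> open U}"

definition weak_star_topology ::
    "complex set \<Rightarrow> 'a normed_space \<Rightarrow> ('a \<Rightarrow> complex) topology" where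
  "weak_star_topology K F =
     topology_generated_by {{\<phi> \<in> dual K F. \<phi> x \<in> U} |x U. x \<in> carrier F \<and> open U}"

text \<open>
  \<^const>\<open>limitin\<close> only constrains the sequence eventually, so membership of all terms is stated
  separately.
\<close>

definition weakly_converges ::
    "complex set \<Rightarrow> 'a normed_space \<Rightarrow> (nat \<Rightarrow> 'a) \<Rightarrow> 'a \<Rightarrow> bool" where
  "weakly_converges K E x a \<longleftrightarrow>
     range x \<subseteq> carrier E \<and> limitin (weak_topology K E) x a sequentially"

definition weak_star_converges ::
    "complex set \<Rightarrow> 'a normed_space \<Rightarrow> (nat \<Rightarrow> 'a \<Rightarrow> complex) \<Rightarrow> ('a \<Rightarrow> complex) \<Rightarrow> bool" where
  "weak_star_converges K F f g \<longleftrightarrow>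
     range f \<subseteq> dual K F \<and> limitin (weak_star_topology K F) f g sequentially"

definition schur_property :: "complex set \<Rightarrow> 'a normed_space \<Rightarrow> bool" where
  "schur_property K E \<longleftrightarrow>
     (\<forall>x a. weakly_converges K E x a \<longrightarrow> (\<exists>b. limitin (norm_topology E) x b sequentially))"

text \<open>
  Points of \<open>E\<^sub>1 \<times> \<dots> \<times> E\<^sub>m\<close> are the elements of the dependent function space over \<open>{1..m}\<close>.
\<close>

definition cont_multilinear ::
    "complex set \<Rightarrow> nat \<Rightarrow> (nat \<Rightarrow> 'a normed_space) \<Rightarrow> 'b normed_space \<Rightarrow>
      ((nat \<Rightarrow> 'a) \<Rightarrow> 'b) set" where
  "cont_multilinear K m E F =
     {T \<in> (\<Pi>\<^sub>E i\<in>{1..m}. carrier (E i)) \<rightarrow>\<^sub>E carrier F.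
        (\<forall>x \<in> (\<Pi>\<^sub>E i\<in>{1..m}. carrier (E i)). \<forall>i\<in>{1..m}.
           (\<forall>u\<in>carrier (E i). \<forall>v\<in>carrier (E i).
              T (x(i := u \<oplus>\<^bsub>E i\<^esub> v)) = T (x(i := u)) \<oplus>\<^bsub>F\<^esub> T (x(i := v))) \<and>
           (\<forall>c\<in>K. \<forall>u\<in>carrier (E i).
              T (x(i := c \<odot>\<^bsub>E i\<^esub> u)) = c \<odot>\<^bsub>F\<^esub> T (x(i := u)))) \<and>
        continuous_map (product_topology (\<lambda>i. norm_topology (E i)) {1..m}) (norm_topology F) T}"

definition weakly_star_DP_at_every_point ::
    "complex set \<Rightarrow> nat \<Rightarrow> (nat \<Rightarrow> 'a normed_space) \<Rightarrow> 'b normed_space \<Rightarrow>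
      ((nat \<Rightarrow> 'a) \<Rightarrow> 'b) \<Rightarrow> bool" where
  "weakly_star_DP_at_every_point K m E F T \<longleftrightarrow>
     (\<forall>a \<in> (\<Pi>\<^sub>E i\<in>{1..m}. carrier (E i)). \<forall>x :: nat \<Rightarrow> nat \<Rightarrow> 'a. \<forall>f. \<forall>g\<in>dual K F.
        (\<forall>i\<in>{1..m}. weakly_converges K (E i) (x i) (a i)) \<longrightarrow>
        weak_star_converges K F f g \<longrightarrow>
        (\<lambda>j. f j (T (\<lambda>i\<in>{1..m}. x i j))) \<longlonglongrightarrow> g (T a))"

definition cont_multilinear_WDP ::
    "complex set \<Rightarrow> nat \<Rightarrow> (nat \<Rightarrow> 'a normed_space) \<Rightarrow> 'b normed_space \<Rightarrow>
      ((nat \<Rightarrow> 'a) \<Rightarrow> 'b) set" where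
  "cont_multilinear_WDP K m E F =
     {T \<in> cont_multilinear K m E F. weakly_star_DP_at_every_point K m E F T}"


lemma (in normed_vector_space) Metric_space_norm_dist:
  assumes K: "K = \<real> \<or> K = UNIV"
  shows "Metric_space (carrier E) (norm_dist E)"
proof
  have m1: "- 1 \<in> K" "1 \<in> K" "0 \<in> K" using K by auto
  have neg: "nrm E (\<ominus>\<^bsub>E\<^esub> x) = nrm E x" if x: "x \<in> carrier E" for x
  proof -
    have "\<zero>\<^bsub>scalars K\<^esub> \<odot>\<^bsub>E\<^esub> x = \<zero>\<^bsub>E\<^esub>"
      using x by (rule smult_l_null)
    then have "(- 1) \<odot>\<^bsub>E\<^esub> x \<oplus>\<^bsub>E\<^esub> x = \<zero>\<^bsub>E\<^esub>"
      using smult_l_distr[of "- 1" 1 x] smult_one[OF x] m1 x by (simp add: scalars_def)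
    then have "\<ominus>\<^bsub>E\<^esub> x = (- 1) \<odot>\<^bsub>E\<^esub> x"
      using x smult_closed[of "- 1" x] m1 by (simp add: scalars_def M.minus_equality)
    then show ?thesis
      using nrm_smult[of "- 1" x] m1 x by simp
  qed
  fix x y z
  show "0 \<le> norm_dist E x y"
    by (simp add: norm_dist_def nrm_nonneg)
  show "norm_dist E x y = norm_dist E y x"
  proof (cases "x \<in> carrier E \<and> y \<in> carrier E")
    case True
    then have "\<ominus>\<^bsub>E\<^esub> (x \<ominus>\<^bsub>E\<^esub> y) = y \<ominus>\<^bsub>E\<^esub> x"
      by (simp add: a_minus_def M.minus_add M.a_comm)
    then show ?thesis
      using True neg[of "x \<ominus>\<^bsub>E\<^esub> y"] by (simp add: norm_dist_def)
  qed (auto simp: norm_dist_def)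
  assume x: "x \<in> carrier E" and y: "y \<in> carrier E"
  show "norm_dist E x y = 0 \<longleftrightarrow> x = y"
  proof -
    have "x = y" if "x \<ominus>\<^bsub>E\<^esub> y = \<zero>\<^bsub>E\<^esub>"
      using that x y M.minus_equality[of x "\<ominus>\<^bsub>E\<^esub> y"] by (simp add: a_minus_def)
    then show ?thesis
      using x y by (auto simp: norm_dist_def nrm_eq_zero a_minus_def M.r_neg)
  qed
  assume z: "z \<in> carrier E"
  have "x \<ominus>\<^bsub>E\<^esub> z = (x \<ominus>\<^bsub>E\<^esub> y) \<oplus>\<^bsub>E\<^esub> (y \<ominus>\<^bsub>E\<^esub> z)"
    using x y z by (simp add: a_minus_def M.a_assoc M.r_neg1)
  then show "norm_dist E x z \<le> norm_dist E x y + norm_dist E y z"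
    using x y z nrm_triangle[of "x \<ominus>\<^bsub>E\<^esub> y" "y \<ominus>\<^bsub>E\<^esub> z"] by (simp add: norm_dist_def)
qed

lemma limitin_topology_generated_by:
  "limitin (topology_generated_by S) f l G \<longleftrightarrow>
     l \<in> \<Union>S \<and> (\<forall>U\<in>S. l \<in> U \<longrightarrow> (\<forall>\<^sub>F j in G. f j \<in> U))"
proof
  assume "limitin (topology_generated_by S) f l G"
  then show "l \<in> \<Union>S \<and> (\<forall>U\<in>S. l \<in> U \<longrightarrow> (\<forall>\<^sub>F j in G. f j \<in> U))"
    by (auto simp: limitin_def topology_generated_by_Basis)
next
  assume r: "l \<in> \<Union>S \<and> (\<forall>U\<in>S. l \<in> U \<longrightarrow> (\<forall>\<^sub>F j in G. f j \<in> U))"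
  have "\<forall>\<^sub>F j in G. f j \<in> U" if "generate_topology_on S U" "l \<in> U" for U
    using that
  proof induction
    case (UN \<K>)
    then obtain k where k: "k \<in> \<K>" "l \<in> k" "\<forall>\<^sub>F j in G. f j \<in> k" by auto
    from k(3) show ?case by (rule eventually_mono) (use k(1) in blast)
  qed (use r in \<open>auto intro: eventually_conj\<close>)
  then show "limitin (topology_generated_by S) f l G"
    using r by (auto simp: limitin_def openin_topology_generated_by_iff)
qed

lemma ball_Collect2:
  "(\<forall>V\<in>{S p U |p U. p \<in> P \<and> Q U}. R V) \<longleftrightarrow> (\<forall>p\<in>P. \<forall>U. Q U \<longrightarrow> R (S p U))"
  by blast

lemma weakly_converges_iff:
  assumes "dual K E \<noteq> {}"
  shows "weakly_converges K E x a \<longleftrightarrow>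
    range x \<subseteq> carrier E \<and> a \<in> carrier E \<and> (\<forall>\<phi>\<in>dual K E. (\<lambda>j. \<phi> (x j)) \<longlonglongrightarrow> \<phi> a)"
proof -
  have "limitin (weak_topology K E) x a sequentially \<longleftrightarrow>
      a \<in> carrier E \<and> (\<forall>\<phi>\<in>dual K E. (\<lambda>j. \<phi> (x j)) \<longlonglongrightarrow> \<phi> a)" if x: "range x \<subseteq> carrier E"
  proof -
    have x': "x j \<in> carrier E" for j using x by auto
    have un: "\<Union>{{x \<in> carrier E. \<phi> x \<in> U} |\<phi> U. \<phi> \<in> dual K E \<and> open U} = carrier E"
      using assms by blast
    show ?thesis
      unfolding weak_topology_def limitin_topology_generated_by tendsto_def un ball_Collect2
      by (auto simp: x')
  qed
  then show ?thesis by (auto simp: weakly_converges_def)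
qed

lemma weak_star_converges_iff:
  assumes "carrier F \<noteq> {}"
  shows "weak_star_converges K F f g \<longleftrightarrow>
    range f \<subseteq> dual K F \<and> g \<in> dual K F \<and> (\<forall>x\<in>carrier F. (\<lambda>j. f j x) \<longlonglongrightarrow> g x)"
proof -
  have "limitin (weak_star_topology K F) f g sequentially \<longleftrightarrow>
      g \<in> dual K F \<and> (\<forall>x\<in>carrier F. (\<lambda>j. f j x) \<longlonglongrightarrow> g x)" if f: "range f \<subseteq> dual K F"
  proof -
    have f': "f j \<in> dual K F" for j using f by auto
    have un: "\<Union>{{\<phi> \<in> dual K F. \<phi> x \<in> U} |x U. x \<in> carrier F \<and> open U} = dual K F"
      using assms by blast
    show ?thesis
      unfolding weak_star_topology_def limitin_topology_generated_by tendsto_def un ball_Collect2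
      by (auto simp: f')
  qed
  then show ?thesis by (auto simp: weak_star_converges_def)
qed

lemma (in normed_vector_space) dual_nonempty:
  assumes K: "K = \<real> \<or> K = UNIV"
  shows "(\<lambda>x\<in>carrier E. 0) \<in> dual K E"
proof -
  interpret X: Metric_space "carrier E" "norm_dist E"
    using K by (rule Metric_space_norm_dist)
  have "0 \<in> K" "\<And>c x. c \<in> K \<Longrightarrow> x \<in> carrier E \<Longrightarrow> c \<odot>\<^bsub>E\<^esub> x \<in> carrier E"
    using K smult_closed by (auto simp: scalars_def)
  moreover have "continuous_map (norm_topology E) euclidean (\<lambda>x\<in>carrier E. 0 :: complex)"
    by (rule continuous_map_eq[where f = "\<lambda>x. 0"]) (auto simp: norm_topology_def)
  ultimately show ?thesis
    by (auto simp: dual_def)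
qed

end

(* Under the Schur property weakly convergent arguments converge in norm, so
   T(x_j^(1), ..., x_j^(m)) converges in norm to T(a_1, ..., a_m).  It remains to see that weak*
   convergence f_j -> f and norm convergence w_j -> w give f_j(w_j) -> f(w).  By Baire's theorem
   some set {x. |f_j(x) - f(x)| <= e for all j >= N} contains a ball, and by additivity this
   estimate can be moved from the centre of the ball to w, where f_j - f tends to 0. *)
theory Submission
  imports Defs
begin

lemma limitin_interleave_const:
  assumes "limitin X x a sequentially"
  shows "limitin X (\<lambda>n. if even n then x (n div 2) else a) a sequentially"
  unfolding limitin_def
proof (intro conjI allI impI)
  show "a \<in> topspace X" using assms by (simp add: limitin_def)
  fix U assume U: "openin X U \<and> a \<in> U"
  with assms obtain N where N: "\<And>n. n \<ge> N \<Longrightarrow> x n \<in> U"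
    unfolding limitin_def eventually_sequentially by blast
  \<comment> \<open>From \<open>2 * N\<close> on, even indices satisfy
    \<open>n div 2 \<ge> N\<close>; at odd indices the value is \<open>a\<close>, which lies in
    \<open>U\<close>.\<close>
  have "(if even n then x (n div 2) else a) \<in> U" if "n \<ge> 2 * N" for n
    using N[of "n div 2"] U that by auto
  then show "\<forall>\<^sub>F n in sequentially. (if even n then x (n div 2) else a) \<in> U"
    unfolding eventually_sequentially by blast
qed

text \<open>
  \<^const>\<open>schur_property\<close> does not say that the norm limit is the weak limit. Interleaving the
  sequence with the constant sequence \<open>a\<close> forces this without the Hahn-Banach theorem.
\<close>

lemma (in normed_vector_space) schur_property_limit:
  assumes K: "K = \<real> \<or> K = UNIV"
    and schur: "schur_property K E"
    and x: "weakly_converges K E x a"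
  shows "limitin (norm_topology E) x a sequentially"
proof -
  interpret X: Metric_space "carrier E" "norm_dist E"
    using K by (rule Metric_space_norm_dist)
  define y where "y = (\<lambda>n. if even n then x (n div 2) else a)"
  \<comment> \<open>The zero functional makes the dual nonempty, so the weak topology has the whole
    carrier as its space.\<close>
  have a: "a \<in> carrier E"
    using x dual_nonempty[OF K] by (subst (asm) weakly_converges_iff) auto
  have "weakly_converges K E y a"
    using x a limitin_interleave_const[of "weak_topology K E" x a]
    by (auto simp: weakly_converges_def y_def)
  then obtain b where b: "limitin X.mtopology y b sequentially"
    using schur by (auto simp: schur_property_def norm_topology_def)
  \<comment> \<open>The odd terms are constantly \<open>a\<close>, which identifies
    \<open>b\<close>; the even terms give back \<open>x\<close>.\<close>
  have "limitin X.mtopology (y \<circ> (\<lambda>n. Suc (2 * n))) b sequentially"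
    using b by (intro limitin_subsequence) (auto simp: strict_mono_def)
  moreover have "y \<circ> (\<lambda>n. Suc (2 * n)) = (\<lambda>_. a)"
    by (auto simp: y_def)
  ultimately have "b = a"
    using X.limitin_metric_unique[of "\<lambda>_. a" b sequentially a] a by simp
  moreover have "limitin X.mtopology (y \<circ> (\<lambda>n. 2 * n)) b sequentially"
    using b by (intro limitin_subsequence) (auto simp: strict_mono_def)
  moreover have "y \<circ> (\<lambda>n. 2 * n) = x"
    by (auto simp: y_def)
  ultimately show ?thesis
    by (simp add: norm_topology_def)
qed

lemma dual_add:
  "\<lbrakk>\<phi> \<in> dual K E; x \<in> carrier E; y \<in> carrier E\<rbrakk> \<Longrightarrow> \<phi> (x \<oplus>\<^bsub>E\<^esub> y) = \<phi> x + \<phi> y"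
  by (simp add: dual_def)

lemma dual_continuous_map: "\<phi> \<in> dual K E \<Longrightarrow> continuous_map (norm_topology E) euclidean \<phi>"
  by (simp add: dual_def)

text \<open>A Baire argument in place of the uniform boundedness principle: the bound is needed only
  on some ball, whose centre \<open>z\<close> is not under control.\<close>

lemma (in banach_space) weak_star_equicontinuous:
  assumes K: "K = \<real> \<or> K = UNIV"
    and f: "range f \<subseteq> dual K E" and g: "g \<in> dual K E"
    and lim: "\<And>x. x \<in> carrier E \<Longrightarrow> (\<lambda>j. f j x) \<longlonglongrightarrow> g x"
    and e: "0 < e"
  obtains N z r where "z \<in> carrier E" "0 < r"
    "\<And>j x. \<lbrakk>j \<ge> N; x \<in> carrier E; norm_dist E z x < r\<rbrakk> \<Longrightarrow> cmod (f j x - g x) \<le> e"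
proof -
  interpret X: Metric_space "carrier E" "norm_dist E"
    using K by (rule Metric_space_norm_dist)
  define A where "A N = {x \<in> carrier E. \<forall>j\<ge>N. cmod (f j x - g x) \<le> e}" for N :: nat
  \<comment> \<open>\<open>A N\<close> is an intersection of preimages of a closed disc under the
    continuous maps \<open>f j - g\<close>.\<close>
  have closed: "closedin X.mtopology (A N)" for N
  proof -
    have "closedin X.mtopology {x \<in> topspace X.mtopology. f j x - g x \<in> cball 0 e}" for j
      using f g by (intro closedin_continuous_map_preimage[where Y = euclidean]
          continuous_map_diff)
        (auto intro!: dual_continuous_map[unfolded norm_topology_def])
    then have "closedin X.mtopology
        (\<Inter>j\<in>{N..}. {x \<in> topspace X.mtopology. f j x - g x \<in> cball 0 e})"
      by (intro closedin_Inter) auto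
    moreover have "(\<Inter>j\<in>{N..}. {x \<in> topspace X.mtopology. f j x - g x \<in> cball 0 e}) = A N"
      by (auto simp: A_def)
    ultimately show ?thesis by simp
  qed
  have "(\<Union>N. A N) = carrier E"
  proof -
    have "\<exists>N. x \<in> A N" if "x \<in> carrier E" for x
      using LIMSEQ_D[OF lim[OF that] e] that by (fastforce simp: A_def intro: less_imp_le)
    then show ?thesis by (auto simp: A_def)
  qed
  \<comment> \<open>If every \<open>A N\<close> had empty interior, so would their union, by
    completeness; but the union is the whole nonempty space.\<close>
  then have "X.mtopology interior_of (\<Union>(range A)) = carrier E"
    using interior_of_topspace[of X.mtopology] by simp
  then have "X.mtopology interior_of (\<Union>(range A)) \<noteq> {}"
    using M.zero_closed by blast
  then obtain N where "X.mtopology interior_of A N \<noteq> {}"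
    using X.metric_Baire_category_alt[OF complete, of "range A"] closed by (auto simp: image_iff)
  then obtain z where "z \<in> X.mtopology interior_of A N" by blast
  then obtain U where U: "openin X.mtopology U" "z \<in> U" "U \<subseteq> A N"
    by (auto simp: interior_of_def)
  then obtain r where r: "0 < r" "X.mball z r \<subseteq> A N"
    unfolding X.openin_mtopology by (meson subset_trans)
  have z: "z \<in> carrier E" using U by (auto simp: A_def)
  show thesis
    using that[OF z r(1)] r(2) z by (auto simp: A_def subset_iff)
qed

text \<open>Split \<open>f j (w j) - g v\<close> into \<open>f j (w j) - g (w j)\<close> and
  \<open>g (w j) - g v\<close>. Continuity of \<open>g\<close> handles the second part, the bound on
  a ball the first.\<close>

lemma (in banach_space) weak_star_norm_tendsto:
  assumes K: "K = \<real> \<or> K = UNIV"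
    and f: "weak_star_converges K E f g"
    and w: "range w \<subseteq> carrier E" "limitin (norm_topology E) w v sequentially"
  shows "(\<lambda>j. f j (w j)) \<longlonglongrightarrow> g v"
proof -
  interpret X: Metric_space "carrier E" "norm_dist E"
    using K by (rule Metric_space_norm_dist)
  have wE: "w j \<in> carrier E" for j using w by auto
  have w': "limitin X.mtopology w v sequentially"
    using w by (simp add: norm_topology_def)
  then have v: "v \<in> carrier E" by (rule X.limitin_mspace)
  have "carrier E \<noteq> {}" using M.zero_closed by blast
  with f have fd: "range f \<subseteq> dual K E" and g: "g \<in> dual K E"
    and lim: "\<And>x. x \<in> carrier E \<Longrightarrow> (\<lambda>j. f j x) \<longlonglongrightarrow> g x"
    by (simp_all add: weak_star_converges_iff)
  have gw: "(\<lambda>j. g (w j)) \<longlonglongrightarrow> g v"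
    using continuous_map_limit[OF dual_continuous_map[OF g] w(2)] by (simp add: o_def)
  have "(\<lambda>j. f j (w j) - g (w j)) \<longlonglongrightarrow> 0"
    unfolding tendsto_iff
  proof (intro allI impI)
    fix e :: real assume "0 < e"
    \<comment> \<open>Three error terms of size at most \<open>e / 4\<close> will add up to strictly
      less than \<open>e\<close>.\<close>
    then have e4: "0 < e / 4" by simp
    obtain N z r where z: "z \<in> carrier E" and r: "0 < r" and
      bd: "\<And>j x. \<lbrakk>j \<ge> N; x \<in> carrier E; norm_dist E z x < r\<rbrakk> \<Longrightarrow> cmod (f j x - g x) \<le> e / 4"
      using weak_star_equicontinuous[OF K fd g lim e4] by metis
    have "(\<lambda>j. f j v - g v) \<longlonglongrightarrow> 0"
      using lim[OF v] LIM_zero by blast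
    then have ev1: "\<forall>\<^sub>F j in sequentially. cmod (f j v - g v) < e / 4"
      using tendstoD[OF _ e4] by (fastforce simp: dist_norm)
    have ev2: "\<forall>\<^sub>F j in sequentially. norm_dist E (w j) v < r"
      using w' r by (auto simp: X.limitin_metric elim: eventually_mono)
    show "\<forall>\<^sub>F j in sequentially. dist (f j (w j) - g (w j)) 0 < e"
      using ev1 ev2 eventually_ge_at_top[of N]
    proof eventually_elim
      case (elim j)
      \<comment> \<open>The small vector from \<open>v\<close> to \<open>w j\<close>, attached to
        the centre \<open>z\<close>, ends at a point \<open>u\<close> of the ball.\<close>
      define u where "u = z \<oplus>\<^bsub>E\<^esub> (w j \<ominus>\<^bsub>E\<^esub> v)"
      have u: "u \<in> carrier E" using z v wE by (simp add: u_def)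
      have uz: "u \<ominus>\<^bsub>E\<^esub> z = w j \<ominus>\<^bsub>E\<^esub> v"
        using z v wE[of j] M.a_comm[of u "\<ominus>\<^bsub>E\<^esub> z"] u M.r_neg1[of z "w j \<ominus>\<^bsub>E\<^esub> v"]
        by (simp add: u_def a_minus_def)
      have "v \<oplus>\<^bsub>E\<^esub> (w j \<ominus>\<^bsub>E\<^esub> v) = w j"
        using v wE[of j] M.a_comm[of "w j" "\<ominus>\<^bsub>E\<^esub> v"] M.r_neg2[of v "w j"]
        by (simp add: a_minus_def)
      then have uv: "v \<oplus>\<^bsub>E\<^esub> u = z \<oplus>\<^bsub>E\<^esub> w j"
        using z v wE[of j] M.a_lcomm[of v z "w j \<ominus>\<^bsub>E\<^esub> v"] by (simp add: u_def)
      have "norm_dist E z u < r"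
        using elim(2) uz u z v wE by (subst X.commute) (simp add: norm_dist_def)
      then have 1: "cmod (f j u - g u) \<le> e / 4" using bd elim(3) u by blast
      have 2: "cmod (f j z - g z) \<le> e / 4" using bd[of j z] elim(3) z r by simp
      \<comment> \<open>Applying additivity to both sides of \<open>uv\<close> expresses the error
        at \<open>w j\<close> by those at \<open>v\<close>, \<open>u\<close> and \<open>z\<close>:
        pointwise convergence bounds the first, the ball estimate the other two.\<close>
      have "f j v + f j u = f j z + f j (w j)" "g v + g u = g z + g (w j)"
        using uv dual_add[of _ K E] fd g z v u wE by (metis rangeI subset_iff)+
      then have "f j (w j) - g (w j) = (f j v - g v) + (f j u - g u) - (f j z - g z)"
        by (simp add: algebra_simps)
      then have "cmod (f j (w j) - g (w j))
          \<le> cmod (f j v - g v) + cmod (f j u - g u) + cmod (f j z - g z)"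
        by (metis norm_triangle_ineq norm_triangle_ineq4 order_trans add_right_mono)
      then show ?case using elim(1) 1 2 e4 by simp
    qed
  qed
  from tendsto_add[OF this gw] show ?thesis by simp
qed

theorem proposition4p8:
  fixes K :: "complex set" and m :: nat
    and E :: "nat \<Rightarrow> 'a normed_space" and F :: "'b normed_space"
  assumes "K = \<real> \<or> K = UNIV"
    and "1 \<le> m"
    and "\<And>i. i \<in> {1..m} \<Longrightarrow> banach_space K (E i)"
    and "banach_space K F"
    and "\<And>i. i \<in> {1..m} \<Longrightarrow> schur_property K (E i)"
  shows "(\<forall>T \<in> cont_multilinear K m E F. weakly_star_DP_at_every_point K m E F T) \<and>
    cont_multilinear_WDP K m E F = cont_multilinear K m E F"
proof -
  interpret F: banach_space K F by fact
  have "weakly_star_DP_at_every_point K m E F T" if T: "T \<in> cont_multilinear K m E F" for T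
    unfolding weakly_star_DP_at_every_point_def
  proof (intro ballI allI impI)
    fix a x f g
    assume a: "a \<in> (\<Pi>\<^sub>E i\<in>{1..m}. carrier (E i))"
      and x: "\<forall>i\<in>{1..m}. weakly_converges K (E i) (x i) (a i)"
      and f: "weak_star_converges K F f g"
    \<comment> \<open>The restriction makes each \<open>p j\<close> extensional, hence a point of
      the product space.\<close>
    define p where "p j = (\<lambda>i\<in>{1..m}. x i j)" for j :: nat
    have p: "p j \<in> (\<Pi>\<^sub>E i\<in>{1..m}. carrier (E i))" for j
      using x by (auto simp: p_def weakly_converges_def)
    have top: "topspace (norm_topology (E i)) = carrier (E i)" if "i \<in> {1..m}" for i
    proof -
      interpret banach_space K "E i" using assms(3) that .
      show ?thesis
        using Metric_space.topspace_mtopology[OF Metric_space_norm_dist[OF assms(1)]]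
        by (simp add: norm_topology_def)
    qed
    have "limitin (norm_topology (E i)) (x i) (a i) sequentially" if i: "i \<in> {1..m}" for i
    proof -
      interpret banach_space K "E i" using assms(3) i .
      show ?thesis using schur_property_limit[OF assms(1) assms(5)[OF i]] x i by blast
    qed
    moreover have "p j \<in> topspace (product_topology (\<lambda>i. norm_topology (E i)) {1..m})" for j
      using p[of j] by (simp add: top PiE_iff)
    \<comment> \<open>Convergence in the product topology is convergence in each coordinate, so
      continuity of \<open>T\<close> carries it over to the norm of \<open>F\<close>.\<close>
    ultimately have "limitin (product_topology (\<lambda>i. norm_topology (E i)) {1..m}) p a sequentially"
      unfolding limitin_componentwise
      using a by (auto simp: p_def PiE_iff)
    then have "limitin (norm_topology F) (T \<circ> p) (T a) sequentially"
      using T by (intro continuous_map_limit) (auto simp: cont_multilinear_def)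
    moreover have "range (T \<circ> p) \<subseteq> carrier F"
      using T p unfolding cont_multilinear_def by fastforce
    ultimately have "(\<lambda>j. f j ((T \<circ> p) j)) \<longlonglongrightarrow> g (T a)"
      using F.weak_star_norm_tendsto[OF assms(1) f] by blast
    then show "(\<lambda>j. f j (T (\<lambda>i\<in>{1..m}. x i j))) \<longlonglongrightarrow> g (T a)"
      by (simp add: p_def)
  qed
  then show ?thesis
    by (auto simp: cont_multilinear_WDP_def)
qed

end
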